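(* For any nontrivial strong PV number $\lambda$ such that $Q_\lambda$ contains a unit of the ring $\mathbb{Z}[\lambda]$ other than $1$, the set $Q_\lambda$ is a Meyer set.
   Context: For $\lambda\in\mathbb{C}$, a set $A\subseteq\mathbb{C}$ is $\lambda$-convex if for all $a,b\in A$ the point $(1-\lambda)a+\lambda b$ is in $A$. $Q_\lambda$ denotes the smallest $\lambda$-convex set containing $\{0,1\}$. A strong PV number is an algebraic integer $\alpha\in\mathbb{C}$ all of whose Galois conjugates over $\mathbb{Q}$, other than $\alpha$ and its complex conjugate $\alpha^*$, lie in the open interval $(0,1)$; it is nontrivial if it has at least one conjugate in $(0,1)$ other than $\alpha$ and $\alpha^*$. A set $A\subseteq\mathbb{R}^n$ is a Meyer set if it is relatively dense in $\mathbb{R}^n$ (there is $R>0$ such that the balls of radius $R$ centered at points of $A$ cover $\mathbb{R}^n$) and $A-A=\{x-y : x,y\in A\}$ is uniformly discrete (distances between distinct points are bounded below by a positive constant). Here "Meyer set" is understood in the ambient space $\mathbb{R}$ if $\lambda\in\mathbb{R}$ (in which case $Q_\lambda\subseteq\mathbb{R}$), and in $\mathbb{C}\cong\mathbb{R}^2$ if $\lambda\in\mathbb{C}\setminus\mathbb{R}$. *)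

theory Defs
  imports "HOL-Analysis.Analysis" "HOL-Computational_Algebra.Computational_Algebra"
begin

definition lambda_convex :: "complex \<Rightarrow> complex set \<Rightarrow> bool" where
  "lambda_convex l A \<longleftrightarrow> (\<forall>a\<in>A. \<forall>b\<in>A. (1 - l) * a + l * b \<in> A)"

definition Q_set :: "complex \<Rightarrow> complex set" where
  "Q_set l = lambda_convex l hull {0, 1}"

lemma lambda_convex_Q_set: "lambda_convex l (Q_set l)"
  unfolding Q_set_def by (rule hull_in) (auto simp: lambda_convex_def)

lemma zero_one_in_Q_set: "{0, 1} \<subseteq> Q_set l"
  unfolding Q_set_def by (rule hull_subset)

lemma Q_set_minimal: "lambda_convex l A \<Longrightarrow> {0, 1} \<subseteq> A \<Longrightarrow> Q_set l \<subseteq> A"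
  unfolding Q_set_def by (rule hull_minimal)

text \<open>An irreducible rational polynomial vanishing at \<open>a\<close> is, up to a nonzero constant, the minimal
  polynomial of \<open>a\<close>. An algebraic number is a conjugate of itself.\<close>

definition galois_conjugate :: "complex \<Rightarrow> complex \<Rightarrow> bool" where
  "galois_conjugate a b \<longleftrightarrow>
     (\<exists>p :: rat poly. irreducible p \<and>
        poly (map_poly of_rat p) a = 0 \<and> poly (map_poly of_rat p) b = 0)"

definition strong_PV :: "complex \<Rightarrow> bool" where
  "strong_PV a \<longleftrightarrow> algebraic_int a \<and>
     (\<forall>b. galois_conjugate a b \<and> b \<noteq> a \<and> b \<noteq> cnj a \<longrightarrow> b \<in> complex_of_real ` {0<..<1})"

definition nontrivial_strong_PV :: "complex \<Rightarrow> bool" where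
  "nontrivial_strong_PV a \<longleftrightarrow> strong_PV a \<and>
     (\<exists>b. galois_conjugate a b \<and> b \<noteq> a \<and> b \<noteq> cnj a \<and> b \<in> complex_of_real ` {0<..<1})"

definition int_adjoin :: "complex \<Rightarrow> complex set" where
  "int_adjoin a = range (\<lambda>p :: int poly. poly (map_poly of_int p) a)"

definition is_unit_of :: "complex set \<Rightarrow> complex \<Rightarrow> bool" where
  "is_unit_of R u \<longleftrightarrow> u \<in> R \<and> (\<exists>v\<in>R. u * v = 1)"

definition relatively_dense :: "'a::euclidean_space set \<Rightarrow> bool" where
  "relatively_dense A \<longleftrightarrow> (\<exists>R>0. (\<Union>x\<in>A. ball x R) = UNIV)"

definition meyer_set :: "'a::euclidean_space set \<Rightarrow> bool" where
  "meyer_set A \<longleftrightarrow> relatively_dense A \<and> uniform_discrete {x - y | x y. x \<in> A \<and> y \<in> A}"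

text \<open>For real \<open>l\<close> the set \<open>Q_set l\<close> is contained in the real line, so its preimage under
  \<^const>\<open>complex_of_real\<close> is the same set, viewed as a subset of \<open>\<real>\<close>.\<close>

definition real_Q_set :: "complex \<Rightarrow> real set" where
  "real_Q_set l = {x. complex_of_real x \<in> Q_set l}"

lemma Q_set_subset_Reals: "l \<in> \<real> \<Longrightarrow> Q_set l \<subseteq> \<real>"
  by (rule Q_set_minimal) (auto simp: lambda_convex_def)

lemma of_real_image_real_Q_set: "l \<in> \<real> \<Longrightarrow> complex_of_real ` real_Q_set l = Q_set l"
  using Q_set_subset_Reals[of l] by (auto simp: real_Q_set_def elim!: Reals_cases)

end

theory Submission
  imports Defs "HOL-Computational_Algebra.Field_as_Ring"
begin

text \<open>Relative density holds as soon as \<open>\<bar>l\<bar> > 1\<close>. Indeed \<open>Q = Q_set l\<close> contains arbitrarily long arithmetic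
  progressions \<open>0, w, 2w, \<dots>\<close>, hence the grids \<open>(1 - l) a w + l b w\<close>, so around some \<open>p \<in> Q\<close> it is dense
  relative to its scale. Expansion in base \<open>l\<close>, with digits from such a grid, propagates this density
  to the whole line or plane. The inequality \<open>\<bar>l\<bar> > 1\<close> comes from the norm of \<open>l\<close>.

  For discreteness, every element of \<open>Q\<close> is \<open>P(l)\<close> for an integer polynomial \<open>P\<close> mapping \<open>[0,1]\<close> to
  itself, so the conjugates of a short vector in \<open>(Q - Q) - (Q - Q)\<close> are all bounded. By interpolation
  at the conjugates of \<open>l\<close>, only finitely many elements of \<open>\<int>[l]\<close> have this property.\<close>

section \<open>Relative density of \<open>Q_set l\<close>\<close>

lemma Q_setD:
  "a \<in> Q_set l \<Longrightarrow> b \<in> Q_set l \<Longrightarrow> (1 - l) * a + l * b \<in> Q_set l"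
  using lambda_convex_Q_set[of l] by (auto simp: lambda_convex_def)

lemma Q_set_0: "0 \<in> Q_set l" and Q_set_1: "1 \<in> Q_set l"
  using zero_one_in_Q_set[of l] by auto

lemma power_in_Q_set: "(1 - l) ^ n \<in> Q_set l"
proof (induction n)
  case (Suc n)
  show ?case using Q_setD[OF Suc Q_set_0] by simp
qed (simp add: Q_set_1)

text \<open>Combining with 0 multiplies a point by \<open>1 - l\<close>, so a progression from 0
  keeps its terms while its step passes from \<open>l * (1 - l) ^ n\<close> to the next such value.
  Each round also gains one term, which makes progressions of any length available.\<close>

lemma progression_in_Q_set:
  "a \<le> Suc n \<Longrightarrow> of_nat a * (l * (1 - l) ^ n) \<in> Q_set l"
proof (induction n arbitrary: a)
  case 0
  then have "a = 0 \<or> a = 1" by auto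
  then show ?case using Q_setD[OF Q_set_0 Q_set_1, of l] by (auto simp: Q_set_0)
next
  case (Suc n)
  show ?case
  proof (cases "a \<le> Suc n")
    case True
    show ?thesis using Q_setD[OF Suc.IH[OF True] Q_set_0] by (simp add: algebra_simps)
  next
    case False
    \<comment> \<open>The extra term comes from the old last term and the power
      \<open>(1 - l) ^ Suc n\<close>: after scaling by \<open>l\<close> that power adds exactly one
      new step.\<close>
    with Suc.prems have a: "a = Suc (Suc n)" by simp
    show ?thesis
      using Q_setD[OF Suc.IH[of "Suc n"] power_in_Q_set[of l "Suc n"]]
      by (simp add: a algebra_simps)
  qed
qed

text \<open>Expansion in base \<open>l\<close>: if \<open>v\<close> approximates \<open>p + (z - p)/l\<close> up to \<open>R\<close>, the error, multiplied by
  \<open>l\<close>, is brought back below \<open>R\<close> by choosing the last digit \<open>q\<close> in \<open>(1 - l) q + l v\<close>.\<close>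

lemma lambda_convex_net:
  fixes V :: "complex set"
  assumes V: "V = \<real> \<or> V = UNIV" and "A \<subseteq> V" "l \<in> V" "l \<noteq> 0"
    and conv: "lambda_convex l A" and p: "p \<in> A"
    and net: "\<And>y. y \<in> V \<Longrightarrow> norm y \<le> norm l * R \<Longrightarrow> \<exists>q\<in>A. norm (y - (1 - l) * (q - p)) \<le> R"
  shows "z \<in> V \<Longrightarrow> norm (z - p) \<le> norm l ^ n * R \<Longrightarrow> \<exists>q\<in>A. norm (z - q) \<le> R"
proof (induction n arbitrary: z)
  case 0
  then show ?case using p by auto
next
  case (Suc n)
  define z' where "z' = p + (z - p) / l"
  have pV: "p \<in> V" using p assms(2) by auto
  have "z' \<in> V" using V pV Suc.prems assms(3) by (auto simp: z'_def)
  moreover have "norm (z' - p) \<le> norm l ^ n * R"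
    using Suc.prems(2) \<open>l \<noteq> 0\<close> by (simp add: z'_def norm_divide field_simps)
  ultimately obtain v where v: "v \<in> A" "norm (z' - v) \<le> R" using Suc.IH by blast
  define y where "y = z - p - l * (v - p)"
  have "v \<in> V" using v assms(2) by auto
  then have "y \<in> V" using V pV Suc.prems(1) assms(3) by (auto simp: y_def)
  moreover have "y = l * (z' - v)" using \<open>l \<noteq> 0\<close> by (simp add: y_def z'_def field_simps)
  then have "norm y \<le> norm l * R" using v by (simp add: norm_mult mult_left_mono)
  ultimately obtain q where q: "q \<in> A" "norm (y - (1 - l) * (q - p)) \<le> R" using net by blast
  have "(1 - l) * q + l * v \<in> A" using conv q v by (auto simp: lambda_convex_def)
  moreover have "z - ((1 - l) * q + l * v) = y - (1 - l) * (q - p)"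
    by (simp add: y_def algebra_simps)
  ultimately show ?case using q by metis
qed

text \<open>For real \<open>l\<close> the identity \<open>(1 - l) + l = 1\<close> lets both
  coordinates equal \<open>z\<close>. For nonreal \<open>l\<close> the vectors \<open>1 - l\<close>
  and \<open>l\<close> form a real basis of the plane. Either way the coordinates are bounded
  linearly, which tells how large a grid must be to cover a given ball.\<close>

lemma affine_coordinates:
  fixes l :: complex
  assumes "V = (if l \<in> \<real> then \<real> else UNIV)"
  shows "\<exists>C>0. \<forall>z\<in>V. \<exists>s t::real. z = of_real s * (1 - l) + of_real t * l
           \<and> \<bar>s\<bar> \<le> C * norm z \<and> \<bar>t\<bar> \<le> C * norm z"
proof (cases "l \<in> \<real>")
  case True
  show ?thesis
  proof (rule exI[of _ 1], intro conjI ballI)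
    fix z :: complex assume "z \<in> V"
    with True assms have "z \<in> \<real>" by simp
    then obtain r where "z = of_real r" by (elim Reals_cases)
    then show "\<exists>s t::real. z = of_real s * (1 - l) + of_real t * l
           \<and> \<bar>s\<bar> \<le> 1 * norm z \<and> \<bar>t\<bar> \<le> 1 * norm z"
      by (intro exI[of _ r]) (simp add: algebra_simps)
  qed simp
next
  case False
  then have im: "Im l \<noteq> 0" by (auto simp: complex_is_Real_iff)
  define c where "c = 1 / \<bar>Im l\<bar>"
  define C where "C = 1 + c * \<bar>Re l\<bar> + c"
  have "c > 0" using im by (simp add: c_def)
  then have "C > 0" unfolding C_def by (intro add_nonneg_pos add_pos_nonneg) auto
  moreover have "\<exists>s t::real. z = of_real s * (1 - l) + of_real t * l
           \<and> \<bar>s\<bar> \<le> C * norm z \<and> \<bar>t\<bar> \<le> C * norm z" for z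
  proof -
    \<comment> \<open>First the coordinates of \<open>z\<close> in the basis 1, \<open>l\<close>;
      replacing 1 by \<open>(1 - l) + l\<close> then turns \<open>(s, m)\<close> into
      \<open>(s, s + m)\<close>.\<close>
    define m where "m = Im z / Im l"
    define s where "s = Re z - m * Re l"
    have m: "\<bar>m\<bar> \<le> c * norm z"
      using abs_Im_le_cmod[of z] im by (simp add: m_def c_def abs_divide divide_right_mono)
    have "\<bar>s\<bar> \<le> \<bar>Re z\<bar> + \<bar>m\<bar> * \<bar>Re l\<bar>" unfolding s_def
      by (metis abs_mult abs_triangle_ineq4)
    also have "\<dots> \<le> norm z + (c * norm z) * \<bar>Re l\<bar>"
      using m abs_Re_le_cmod[of z] by (intro add_mono mult_right_mono) auto
    finally have s: "\<bar>s\<bar> \<le> (1 + c * \<bar>Re l\<bar>) * norm z" by (simp add: algebra_simps)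
    have "z = of_real s + of_real m * l"
      using im by (simp add: complex_eq_iff s_def m_def)
    then have "z = of_real s * (1 - l) + of_real (s + m) * l"
      by (simp add: algebra_simps)
    moreover have "\<bar>s\<bar> \<le> C * norm z"
      using order_trans[OF s, of "C * norm z"] \<open>c > 0\<close> by (simp add: C_def mult_right_mono)
    moreover have "\<bar>s + m\<bar> \<le> C * norm z"
      using s m by (simp add: C_def algebra_simps)
    ultimately show ?thesis by blast
  qed
  ultimately show ?thesis by blast
qed

lemma Q_set_dense:
  assumes V: "V = (if l \<in> \<real> then \<real> else UNIV)" and l: "norm l > 1"
  shows "\<exists>R>0. \<forall>z\<in>V. \<exists>q\<in>Q_set l. norm (z - q) \<le> R"
proof -
  obtain C where "C > 0" and C: "\<forall>z\<in>V. \<exists>s t::real. z = of_real s * (1 - l) + of_real t * l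
           \<and> \<bar>s\<bar> \<le> C * norm z \<and> \<bar>t\<bar> \<le> C * norm z"
    using affine_coordinates[OF V] by blast
  define r where "r = norm (1 - l) + norm l"
  \<comment> \<open>The ball of radius \<open>norm l * R\<close>, divided by
    \<open>(1 - l) * w\<close>, has radius \<open>norm l * r\<close>. So the required grid size does
    not depend on \<open>w\<close>, and \<open>w\<close> may be built from \<open>H\<close> without
    circularity. The summand 1 leaves room for rounding.\<close>
  obtain H :: nat where H: "real H \<ge> C * (norm l * r) + 1" using real_arch_simple by blast
  define w where "w = l * (1 - l) ^ (2 * H)"
  \<comment> \<open>The midpoint of the progression, so that grid points have signed coordinates
    from \<open>-H\<close> to \<open>H\<close> relative to \<open>p\<close>, which equals
    \<open>(1 - l) * p + l * p\<close>.\<close>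
  define p where "p = of_nat H * w"
  \<comment> \<open>The cost of rounding both coordinates by at most 1, after the grid has been
    scaled by \<open>1 - l\<close>.\<close>
  define R where "R = norm ((1 - l) * w) * r"
  have "l \<noteq> 0" "l \<noteq> 1" using l by auto
  then have "w \<noteq> 0" by (simp add: w_def)
  have "r > 0" unfolding r_def using l by (intro add_nonneg_pos) auto
  then have "R > 0" using \<open>l \<noteq> 1\<close> \<open>w \<noteq> 0\<close> by (simp add: R_def)
  have prog: "of_nat a * w \<in> Q_set l" if "a \<le> 2 * H" for a
    unfolding w_def using that by (intro progression_in_Q_set) simp
  have VV: "V = \<real> \<or> V = UNIV" using V by auto
  have QV: "Q_set l \<subseteq> V" using V Q_set_subset_Reals by auto
  have lV: "l \<in> V" using V by auto
  have p: "p \<in> Q_set l" unfolding p_def by (rule prog) simp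
  have "real H \<ge> 1" using H \<open>C > 0\<close> \<open>r > 0\<close> by (smt (verit) mult_nonneg_nonneg norm_ge_zero)
  then have wV: "w \<in> V" using prog[of 1] QV by auto
  have net: "\<exists>q\<in>Q_set l. norm (y - (1 - l) * (q - p)) \<le> R"
    if y: "y \<in> V" "norm y \<le> norm l * R" for y
  proof -
    define y' where "y' = y / ((1 - l) * w)"
    have y': "y = (1 - l) * w * y'" using \<open>l \<noteq> 1\<close> \<open>w \<noteq> 0\<close> by (simp add: y'_def)
    have "y' \<in> V" using y wV lV VV by (auto simp: y'_def)
    have ny': "norm y' \<le> norm l * r"
    proof -
      have "norm y' = norm y / norm ((1 - l) * w)" by (simp add: y'_def norm_divide)
      also have "\<dots> \<le> norm l * R / norm ((1 - l) * w)" using y by (simp add: divide_right_mono)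
      also have "\<dots> = norm l * r" using \<open>l \<noteq> 1\<close> \<open>w \<noteq> 0\<close> by (simp add: R_def)
      finally show ?thesis .
    qed
    obtain s t where st: "y' = of_real s * (1 - l) + of_real t * l"
      "\<bar>s\<bar> \<le> C * norm y'" "\<bar>t\<bar> \<le> C * norm y'" using C \<open>y' \<in> V\<close> by blast
    have "C * norm y' \<le> real H - 1"
      using mult_left_mono[OF ny', of C] \<open>C > 0\<close> H by linarith
    with st have b: "\<bar>s\<bar> \<le> real H - 1" "\<bar>t\<bar> \<le> real H - 1" by auto
    define i j where "i = \<lfloor>s\<rfloor>" and "j = \<lfloor>t\<rfloor>"
    \<comment> \<open>Rounding down lowers a coordinate by less than 1, which the bound
      \<open>real H - 1\<close> absorbs.\<close>
    have ij: "\<bar>i\<bar> \<le> int H" "\<bar>j\<bar> \<le> int H" unfolding i_def j_def using b by linarith+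
    define a b where "a = nat (int H + i)" and "b = nat (int H + j)"
    have ab: "a \<le> 2 * H" "b \<le> 2 * H" "of_nat a = (of_nat H + of_int i :: complex)"
      "of_nat b = (of_nat H + of_int j :: complex)"
      using ij by (auto simp: a_def b_def of_nat_nat)
    define q where "q = (1 - l) * (of_nat a * w) + l * (of_nat b * w)"
    have "q \<in> Q_set l" unfolding q_def using ab by (intro Q_setD prog)
    have "q - p = w * (of_int i * (1 - l) + of_int j * l)"
      by (simp add: q_def p_def ab algebra_simps)
    then have "y - (1 - l) * (q - p) =
        (1 - l) * w * (of_real (s - of_int i) * (1 - l) + of_real (t - of_int j) * l)"
      by (simp only: y' st(1)) (simp add: algebra_simps)
    moreover have "norm (of_real (s - of_int i) * (1 - l) + of_real (t - of_int j) * l) \<le> r"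
    proof -
      have "\<bar>s - of_int i\<bar> \<le> 1" "\<bar>t - of_int j\<bar> \<le> 1" unfolding i_def j_def by linarith+
      then have "norm (of_real (s - of_int i) * (1 - l)) \<le> norm (1 - l)"
        "norm (of_real (t - of_int j) * l) \<le> norm l"
        unfolding norm_mult norm_of_real by (auto intro: mult_left_le_one_le)
      then show ?thesis unfolding r_def by (intro norm_triangle_le) linarith
    qed
    ultimately have "norm (y - (1 - l) * (q - p)) \<le> R"
      unfolding R_def by (simp only: norm_mult) (intro mult_left_mono, auto)
    with \<open>q \<in> Q_set l\<close> show ?thesis by blast
  qed
  have "\<exists>q\<in>Q_set l. norm (z - q) \<le> R" if "z \<in> V" for z
  proof -
    obtain n where "norm (z - p) / R < norm l ^ n" using real_arch_pow[OF l] by blast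
    then have "norm (z - p) \<le> norm l ^ n * R" using \<open>R > 0\<close> by (simp add: field_simps)
    then show ?thesis
      using lambda_convex_net[OF VV QV lV \<open>l \<noteq> 0\<close> lambda_convex_Q_set p net that] by blast
  qed
  with \<open>R > 0\<close> show ?thesis by blast
qed

section \<open>Changes of coefficient ring, minimal polynomials and Gauss' lemma\<close>

lemma map_poly_of_int_mult:
  "map_poly of_int (p * q) = (map_poly of_int p * map_poly of_int q :: 'a::comm_ring_1 poly)"
  by (intro poly_eqI) (simp add: coeff_map_poly coeff_mult)

lemma map_poly_of_int_add:
  "map_poly of_int (p + q) = (map_poly of_int p + map_poly of_int q :: 'a::comm_ring_1 poly)"
  by (intro poly_eqI) (simp add: coeff_map_poly)

lemma map_poly_of_int_diff:
  "map_poly of_int (p - q) = (map_poly of_int p - map_poly of_int q :: 'a::comm_ring_1 poly)"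
  by (intro poly_eqI) (simp add: coeff_map_poly)

lemma map_poly_of_rat_mult:
  "map_poly of_rat (p * q) = (map_poly of_rat p * map_poly of_rat q :: 'a::field_char_0 poly)"
  by (intro poly_eqI) (simp add: coeff_map_poly coeff_mult of_rat_sum of_rat_mult)

lemma map_poly_of_rat_add:
  "map_poly of_rat (p + q) = (map_poly of_rat p + map_poly of_rat q :: 'a::field_char_0 poly)"
  by (intro poly_eqI) (simp add: coeff_map_poly of_rat_add)

lemma map_poly_of_rat_smult:
  "map_poly of_rat (smult c q) = (smult (of_rat c) (map_poly of_rat q) :: 'a::field_char_0 poly)"
  by (intro poly_eqI) (simp add: coeff_map_poly of_rat_mult)

lemma map_poly_of_rat_of_int:
  "map_poly of_rat (map_poly of_int p) = (map_poly of_int p :: 'a::field_char_0 poly)"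
  by (intro poly_eqI) (simp add: coeff_map_poly)

lemma map_poly_of_rat_pderiv:
  "map_poly of_rat (pderiv p) = (pderiv (map_poly of_rat p) :: 'a::field_char_0 poly)"
  by (intro poly_eqI) (simp add: coeff_map_poly coeff_pderiv of_rat_mult of_rat_add)

text \<open>Otherwise \<open>p\<close> and \<open>q\<close> would be coprime, and a Bezout identity
  evaluated at the common root \<open>a\<close> would read 0 = 1.\<close>

lemma irreducible_dvd_of_root:
  fixes p q :: "rat poly" and a :: "'a::field_char_0"
  assumes "irreducible p" "poly (map_poly of_rat p) a = 0" "poly (map_poly of_rat q) a = 0"
  shows "p dvd q"
proof (rule ccontr)
  assume "\<not> p dvd q"
  then have "coprime p q" using assms(1)
    using irreducibleD'[OF assms(1)] dvd_trans by (blast intro: coprimeI)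
  then obtain u v where "u * p + v * q = 1"
    using bezout_coefficients_fst_snd[of p q] coprime_imp_gcd_eq_1[of p q] by metis
  then have "poly (map_poly of_rat (u * p + v * q)) a = 1" by simp
  with assms show False
    by (simp add: map_poly_of_rat_add map_poly_of_rat_mult)
qed

lemma clear_denominators:
  fixes p :: "rat poly"
  shows "\<exists>d r. d \<noteq> 0 \<and> smult (of_int d) p = map_poly of_int r"
proof (induction p)
  case 0
  show ?case by (rule exI[of _ 1], rule exI[of _ 0]) simp
next
  case (pCons c p)
  then obtain d r where dr: "d \<noteq> 0" "smult (of_int d) p = map_poly of_int r" by blast
  obtain a b where ab: "quotient_of c = (a, b)" by (cases "quotient_of c")
  then have "b > 0" "c = of_int a / of_int b"
    using quotient_of_denom_pos quotient_of_div by auto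
  then have "smult (of_int (b * d)) (pCons c p) = map_poly of_int (pCons (a * d) (smult b r))"
    using dr(2) by (intro poly_eqI)
      (auto simp: coeff_map_poly coeff_pCons poly_eq_iff mult.assoc split: nat.splits)
  then show ?case using \<open>b > 0\<close> dr(1) by (intro exI[of _ "b * d"]) auto
qed

text \<open>Gauss' lemma, by comparing contents and leading coefficients in \<open>e f = g0 k\<close>.\<close>

lemma monic_integral_multiple:
  fixes p :: "rat poly" and a :: complex
  assumes irr: "irreducible p" and root: "poly (map_poly of_rat p) a = 0" and "algebraic_int a"
  obtains g :: "int poly" and c where "lead_coeff g = 1" "c \<noteq> 0" "map_poly of_int g = smult c p"
proof -
  from assms obtain f :: "int poly" where f: "poly (map_poly of_int f) a = 0" "lead_coeff f = 1"
    by (auto simp: algebraic_int_altdef_ipoly)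
  obtain d r where dr: "d \<noteq> 0" "smult (of_int d) p = map_poly of_int r"
    using clear_denominators by blast
  have "p \<noteq> 0" using irr by auto
  then have "r \<noteq> 0" using dr by auto
  define g0 where "g0 = primitive_part r"
  have r: "r = smult (content r) g0" by (simp add: g0_def)
  have "smult (of_int d) p = smult (of_int (content r)) (map_poly of_int g0)"
    unfolding dr by (subst r, intro poly_eqI) (simp add: coeff_map_poly)
  then have "smult (1 / of_int (content r)) (smult (of_int d) p) = map_poly of_int g0"
    using \<open>r \<noteq> 0\<close> by simp
  then have g0: "map_poly of_int g0 = smult (of_int d / of_int (content r)) p" by simp
  have nz: "(of_int d / of_int (content r) :: rat) \<noteq> 0" using dr \<open>r \<noteq> 0\<close> by simp
  have "p dvd map_poly of_int f"
    using irreducible_dvd_of_root[OF irr root] f by (simp add: map_poly_of_rat_of_int)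
  then have "map_poly of_int g0 dvd (map_poly of_int f :: rat poly)"
    unfolding g0 using nz by (simp add: smult_dvd_iff)
  then obtain h :: "rat poly" where h: "map_poly of_int f = map_poly of_int g0 * h" by blast
  obtain e k where ek: "e \<noteq> 0" "smult (of_int e) h = map_poly of_int k"
    using clear_denominators by blast
  have "(map_poly of_int (smult e f) :: rat poly) = smult (of_int e) (map_poly of_int f)"
    by (intro poly_eqI) (simp add: coeff_map_poly)
  also have "\<dots> = map_poly of_int (g0 * k)"
    using ek by (simp add: h map_poly_of_int_mult flip: mult_smult_right)
  finally have fk: "smult e f = g0 * k"
    by (simp add: poly_eq_iff coeff_map_poly flip: of_int_mult)
  \<comment> \<open>\<open>f\<close> is monic and \<open>g0\<close> primitive, so multiplicativity
    of the content puts all of \<open>e\<close> into \<open>k\<close>. Hence \<open>e\<close>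
    already divides the leading coefficient of \<open>k\<close>, and what remains for
    \<open>g0\<close> is a unit.\<close>
  have "content f = 1"
    using content_dvd_coeff[of f "degree f"] f(2) normalize_content[of f]
    by (metis is_unit_normalize)
  moreover have "content g0 = 1" using \<open>r \<noteq> 0\<close> by (simp add: g0_def)
  ultimately have "\<bar>e\<bar> = content k"
    using arg_cong[OF fk, of content] by (simp add: content_mult)
  then have "e dvd lead_coeff k" by (metis abs_dvd_iff content_dvd_coeff)
  then obtain m where m: "lead_coeff k = e * m" by blast
  have "e = lead_coeff g0 * lead_coeff k"
    using arg_cong[OF fk, of lead_coeff] f(2) ek(1) by (simp add: lead_coeff_mult)
  then have "lead_coeff g0 * m = 1" using m ek(1) by (simp add: mult.left_commute)
  then have "lead_coeff g0 = 1 \<or> lead_coeff g0 = -1" by (auto simp: zmult_eq_1_iff)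
  then have "lead_coeff g0 * lead_coeff g0 = 1" by auto
  have "g0 \<noteq> 0" using \<open>content g0 = 1\<close> by auto
  show ?thesis
  proof
    \<comment> \<open>The leading coefficient is 1 or -1, so multiplying by it corrects the
      sign.\<close>
    show "lead_coeff (smult (lead_coeff g0) g0) = 1"
      by (simp add: \<open>g0 \<noteq> 0\<close> \<open>lead_coeff g0 * lead_coeff g0 = 1\<close>)
    show "map_poly of_int (smult (lead_coeff g0) g0)
      = smult (of_int (lead_coeff g0) * (of_int d / of_int (content r))) p"
      using g0 by (simp add: poly_eq_iff coeff_map_poly mult.assoc)
    show "of_int (lead_coeff g0) * (of_int d / of_int (content r)) \<noteq> (0::rat)"
      using nz \<open>lead_coeff g0 * lead_coeff g0 = 1\<close> by (metis mult_eq_0_iff of_int_eq_0_iff zero_neq_one)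
  qed
qed

section \<open>Finiteness of integer polynomials with bounded values\<close>

lemma division_by_monic:
  fixes g :: "'a::comm_ring_1 poly"
  assumes "lead_coeff g = 1" "degree g > 0"
  shows "\<exists>q r. P = g * q + r \<and> degree r < degree g"
proof (induction "degree P" arbitrary: P rule: less_induct)
  case less
  show ?case
  proof (cases "degree P < degree g")
    case True
    then show ?thesis by (intro exI[of _ 0] exI[of _ P]) simp
  next
    case False
    define P' where "P' = P - g * monom (lead_coeff P) (degree P - degree g)"
    have "degree (g * monom (lead_coeff P) (degree P - degree g)) \<le> degree P"
      using False degree_mult_le[of g "monom (lead_coeff P) (degree P - degree g)"]
        degree_monom_le[of "lead_coeff P" "degree P - degree g"] by linarith
    then have "degree P' \<le> degree P" by (simp add: P'_def degree_diff_le)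
    moreover have "coeff P' (degree P) = 0"
      using False assms(1) by (simp add: P'_def mult.commute[of g] coeff_monom_mult)
    \<comment> \<open>If \<open>P'\<close> vanishes, its degree is 0 by convention; this is still
      below \<open>degree P\<close>, since \<open>degree g > 0\<close>.\<close>
    ultimately have "degree P' < degree P"
      using False assms(2) eq_zero_or_degree_less[of P' "degree P"] by auto
    then obtain q r where "P' = g * q + r" "degree r < degree g" using less by blast
    then show ?thesis
      by (intro exI[of _ "q + monom (lead_coeff P) (degree P - degree g)"] exI[of _ r])
        (simp add: P'_def algebra_simps)
  qed
qed

text \<open>A quantitative form of interpolation. Splitting off a node \<open>a\<close> writes P as
  \<open>(X - a) Q + P(a)\<close>; at the other nodes Q is a difference quotient of P, hence
  bounded. The alternative \<open>P = 0\<close> keeps the induction going down to the empty set,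
  where no degree is small enough.\<close>

lemma coeffs_bounded_by_values:
  fixes A :: "complex set"
  assumes "finite A"
  shows "\<exists>C. \<forall>P. (P = 0 \<or> degree P < card A) \<longrightarrow> (\<forall>a\<in>A. norm (poly P a) \<le> B)
           \<longrightarrow> (\<forall>i. norm (coeff P i) \<le> C)"
  using assms
proof (induction A arbitrary: B)
  case empty
  show ?case by (intro exI[of _ 0]) auto
next
  case (insert a A)
  \<comment> \<open>A lower bound for the denominators \<open>x - a\<close> of the difference
    quotients.\<close>
  obtain m where m: "m > 0" "\<forall>x\<in>A. x \<noteq> a \<longrightarrow> m \<le> dist a x"
    using finite_set_avoid insert.hyps(1) by blast
  obtain C where C: "\<And>P i. (P = 0 \<or> degree P < card A) \<Longrightarrow> (\<forall>a\<in>A. norm (poly P a) \<le> 2 * B / m)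
           \<Longrightarrow> norm (coeff P i) \<le> C"
    using insert.IH[of "2 * B / m"] by blast
  show ?case
  proof (intro exI allI impI)
    fix P i
    assume deg: "P = 0 \<or> degree P < card (insert a A)"
      and bd: "\<forall>x\<in>insert a A. norm (poly P x) \<le> B"
    define Q where "Q = synthetic_div P a"
    have P: "P = [:- a, 1:] * Q + [:poly P a:]"
      using synthetic_div_correct'[of a P] by (simp add: Q_def)
    have "Q = 0 \<or> degree Q < card A"
      using deg insert.hyps synthetic_div_eq_0_iff[of P a]
      by (auto simp: Q_def degree_synthetic_div)
    moreover have "\<forall>x\<in>A. norm (poly Q x) \<le> 2 * B / m"
    proof
      fix x assume x: "x \<in> A"
      then have "x \<noteq> a" using insert.hyps by auto
      have "(x - a) * poly Q x = poly P x - poly P a"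
        using arg_cong[OF P, of "\<lambda>p. poly p x"] by (simp add: algebra_simps)
      then have "dist a x * norm (poly Q x) = norm (poly P x - poly P a)"
        by (metis dist_commute dist_norm norm_mult)
      also have "\<dots> \<le> 2 * B"
        using bd x norm_triangle_ineq4[of "poly P x" "poly P a"] by fastforce
      finally have "dist a x * norm (poly Q x) \<le> 2 * B" .
      moreover have "m * norm (poly Q x) \<le> dist a x * norm (poly Q x)"
        using m x \<open>x \<noteq> a\<close> by (intro mult_right_mono) auto
      ultimately show "norm (poly Q x) \<le> 2 * B / m"
        using m(1) by (simp add: field_simps)
    qed
    ultimately have Q: "norm (coeff Q i) \<le> C" for i using C by blast
    \<comment> \<open>Needed at index 0, where the coefficient of \<open>pCons 0 Q\<close> is
      0.\<close>
    have "C \<ge> 0" using order_trans[OF norm_ge_zero Q] .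
    have "coeff P i = coeff (pCons 0 Q) i - a * coeff Q i + coeff [:poly P a:] i"
      using arg_cong[OF P, of "\<lambda>p. coeff p i"] by (simp add: coeff_pCons split: nat.splits)
    also have "norm \<dots> \<le> norm (coeff (pCons 0 Q) i) + norm (a * coeff Q i) + norm (coeff [:poly P a:] i)"
      by (meson add_right_mono norm_triangle_ineq norm_triangle_ineq4 order_trans)
    also have "\<dots> \<le> C + norm a * C + B"
    proof (intro add_mono)
      show "norm (coeff (pCons 0 Q) i) \<le> C" using Q \<open>C \<ge> 0\<close> by (auto simp: coeff_pCons split: nat.splits)
      show "norm (a * coeff Q i) \<le> norm a * C" using Q by (simp add: norm_mult mult_left_mono)
      have "norm (poly P a) \<le> B" using bd by auto
      moreover from this have "0 \<le> B" using norm_ge_zero order_trans by blast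
      ultimately show "norm (coeff [:poly P a:] i) \<le> B"
        by (auto simp: coeff_pCons split: nat.splits)
    qed
    finally show "norm (coeff P i) \<le> C + norm a * C + B" .
  qed
qed

lemma finite_bounded_int_polys:
  "finite {R :: int poly. degree R < n \<and> (\<forall>i. \<bar>coeff R i\<bar> \<le> C)}"
proof (rule finite_subset)
  show "{R :: int poly. degree R < n \<and> (\<forall>i. \<bar>coeff R i\<bar> \<le> C)}
      \<subseteq> Poly ` {xs. set xs \<subseteq> {-C..C} \<and> length xs \<le> n}"
  proof
    fix R :: "int poly" assume R: "R \<in> {R. degree R < n \<and> (\<forall>i. \<bar>coeff R i\<bar> \<le> C)}"
    have "set (coeffs R) \<subseteq> {-C..C}"
      using R by (auto simp: coeffs_def abs_le_iff minus_le_iff simp del: upt_Suc)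
    moreover have "length (coeffs R) \<le> n"
      using R by (cases "R = 0") (auto simp: length_coeffs_degree)
    ultimately show "R \<in> Poly ` {xs. set xs \<subseteq> {-C..C} \<and> length xs \<le> n}"
      by (intro image_eqI[of _ _ "coeffs R"]) auto
  qed
qed (intro finite_imageI finite_lists_length_le, simp)

text \<open>A multiple root would be shared with the derivative, so the irreducible \<open>p\<close>
  would divide \<open>pderiv p\<close>. That polynomial is nonzero in characteristic 0 and has
  smaller degree. Thus the number of conjugates is exactly the degree, as interpolation
  requires.\<close>

lemma separable_decomposition:
  fixes p :: "rat poly"
  assumes irr: "irreducible p"
  shows "finite {z::complex. poly (map_poly of_rat p) z = 0}"
    and "(map_poly of_rat p :: complex poly) = smult (of_rat (lead_coeff p))
      (\<Prod>z | poly (map_poly of_rat p) z = 0. [:-z, 1:])"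
    and "card {z::complex. poly (map_poly of_rat p) z = 0} = degree p"
proof -
  let ?P = "map_poly of_rat p :: complex poly"
  have deg: "degree ?P = degree p" by (simp add: degree_map_poly)
  have "p \<noteq> 0" using irr by auto
  have "degree p > 0" using irr \<open>p \<noteq> 0\<close>
    by (metis irreducible_def is_unit_iff_degree gr0I)
  have nz: "?P \<noteq> 0" using \<open>degree p > 0\<close> deg by (metis degree_0 less_irrefl)
  show fin: "finite {z. poly ?P z = 0}" using nz by (rule poly_roots_finite)
  have "rsquarefree ?P"
    unfolding rsquarefree_roots
  proof (intro allI notI, elim conjE)
    fix z assume z: "poly ?P z = 0" "poly (pderiv ?P) z = 0"
    then have "p dvd pderiv p"
      by (intro irreducible_dvd_of_root[OF irr]) (simp_all add: map_poly_of_rat_pderiv)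
    moreover have "pderiv p \<noteq> 0" using \<open>degree p > 0\<close> by (simp add: pderiv_eq_0_iff)
    ultimately have "degree p \<le> degree (pderiv p)" by (rule dvd_imp_degree_le)
    with \<open>degree p > 0\<close> show False by (simp add: degree_pderiv)
  qed
  then show dec: "?P = smult (of_rat (lead_coeff p)) (\<Prod>z | poly ?P z = 0. [:-z, 1:])"
    using complex_poly_decompose_rsquarefree[of ?P] by (simp add: deg coeff_map_poly)
  have "degree (\<Prod>z | poly ?P z = 0. [:-z, 1:]) = card {z. poly ?P z = 0}"
    by (subst degree_prod_sum_eq) auto
  then show "card {z. poly ?P z = 0} = degree p"
    using arg_cong[OF dec, of degree] \<open>p \<noteq> 0\<close> by (simp add: deg)
qed

section \<open>Conjugates of the elements of \<open>Q_set l\<close>\<close>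

text \<open>The polynomials with this property contain the constants 0 and 1 and are closed under
  \<open>(1 - X) P + X P'\<close>, because at \<open>t\<close> in [0,1] this is a convex combination
  of two values. Evaluated at \<open>l\<close>, the same operation is the one defining
  \<open>lambda_convex\<close>, so minimality of \<open>Q_set l\<close> applies.\<close>

lemma Q_set_int_poly:
  assumes "x \<in> Q_set l"
  shows "\<exists>P. x = poly (map_poly of_int P) l \<and>
    (\<forall>t\<in>{0..1}. \<exists>r\<in>{0..1}. poly (map_poly of_int P) (of_real t) = (of_real r :: complex))"
proof -
  let ?good = "\<lambda>P. \<forall>t\<in>{0..1}. \<exists>r\<in>{0..1}. poly (map_poly of_int P) (of_real t) = (of_real r :: complex)"
  let ?S = "{poly (map_poly of_int P) l | P. ?good P}"
  have "lambda_convex l ?S"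
    unfolding lambda_convex_def
  proof (intro ballI)
    fix a b assume "a \<in> ?S" "b \<in> ?S"
    then obtain P P' where P: "a = poly (map_poly of_int P) l" "?good P"
      and P': "b = poly (map_poly of_int P') l" "?good P'" by blast
    let ?R = "[:1, -1:] * P + [:0, 1:] * P'"
    have ev: "poly (map_poly of_int ?R) z = (1 - z) * poly (map_poly of_int P) z
        + z * poly (map_poly of_int P') z" for z :: complex
      by (simp only: map_poly_of_int_add map_poly_of_int_mult poly_add poly_mult)
        (simp add: map_poly_pCons algebra_simps)
    have "?good ?R"
    proof
      fix t :: real assume t: "t \<in> {0..1}"
      with P P' obtain r r' where r: "r \<in> {0..1}" "r' \<in> {0..1}"
        "poly (map_poly of_int P) (of_real t) = (of_real r :: complex)"
        "poly (map_poly of_int P') (of_real t) = (of_real r' :: complex)" by metis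
      have "(1 - t) * r + t * r' \<in> {0..1}"
        using convexD_alt[OF convex_real_interval(5)[of 0 1] r(1,2), of t] t by simp
      then show "\<exists>r\<in>{0..1}. poly (map_poly of_int ?R) (of_real t) = (of_real r :: complex)"
        unfolding ev r by (intro bexI) simp_all
    qed
    then show "(1 - l) * a + l * b \<in> ?S" using ev[of l] P P' by (intro CollectI exI[of _ ?R]) simp
  qed
  moreover have "{0, 1} \<subseteq> ?S"
  proof -
    have "0 \<in> ?S" by (intro CollectI exI[of _ 0]) auto
    moreover have "1 \<in> ?S" by (intro CollectI exI[of _ 1]) (auto intro: bexI[of _ 1])
    ultimately show ?thesis by simp
  qed
  ultimately show ?thesis using Q_set_minimal[of l ?S] assms by auto
qed

text \<open>Modulo the monic integral minimal polynomial, \<open>P\<close> reduces to an integer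
  polynomial with the same values at all conjugates and degree below their number. The two bounds
  control these values: the first at \<open>l\<close> and \<open>cnj l\<close>, the second at the
  conjugates in (0,1). Interpolation then bounds the integer coefficients.\<close>

lemma strong_PV_finite:
  assumes "strong_PV l" and irr: "irreducible p" and root: "poly (map_poly of_rat p) l = 0"
  shows "finite {poly (map_poly of_int P) l | P. norm (poly (map_poly of_int P) l) \<le> B \<and>
    (\<forall>t\<in>{0..1}. norm (poly (map_poly of_int P) (complex_of_real t)) \<le> B)}" (is "finite ?T")
proof -
  let ?A = "{z::complex. poly (map_poly of_rat p) z = 0}"
  obtain g c where g: "lead_coeff g = 1" "c \<noteq> 0" "map_poly of_int g = smult c p"
    using monic_integral_multiple[OF irr root] assms(1) by (auto simp: strong_PV_def)
  have deg: "degree g = degree p"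
    using g by (metis degree_map_poly degree_smult_eq of_int_eq_0_iff)
  have card: "card ?A = degree g" and fin: "finite ?A"
    using separable_decomposition[OF irr] deg by auto
  then have "degree g > 0" using root by (metis (mono_tags) card_gt_0_iff empty_iff mem_Collect_eq)
  have groot: "poly (map_poly of_int g) z = 0" if "z \<in> ?A" for z :: complex
    using that arg_cong[OF g(3), of "map_poly (of_rat :: rat \<Rightarrow> complex)"]
    by (simp add: map_poly_of_rat_of_int map_poly_of_rat_smult)
  obtain C where C: "\<And>P. (P = 0 \<or> degree P < card ?A) \<Longrightarrow> (\<forall>a\<in>?A. norm (poly P a) \<le> B)
           \<Longrightarrow> (\<forall>i. norm (coeff P i) \<le> C)"
    using coeffs_bounded_by_values[OF fin, of B] by blast
  have "?T \<subseteq> (\<lambda>R. poly (map_poly of_int R) l) `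
      {R. degree R < degree g \<and> (\<forall>i. \<bar>coeff R i\<bar> \<le> \<lfloor>C\<rfloor>)}"
  proof
    fix x assume "x \<in> ?T"
    then obtain P where P: "x = poly (map_poly of_int P) l"
      "norm (poly (map_poly of_int P) l) \<le> B"
      "\<forall>t\<in>{0..1}. norm (poly (map_poly of_int P) (complex_of_real t)) \<le> B" by blast
    obtain q R where R: "P = g * q + R" "degree R < degree g"
      using division_by_monic[OF g(1) \<open>degree g > 0\<close>] by blast
    have PR: "poly (map_poly of_int P) z = poly (map_poly of_int R) z" if "z \<in> ?A" for z :: complex
      using groot[OF that] by (simp add: R(1) map_poly_of_int_add map_poly_of_int_mult)
    have "norm (poly (map_poly of_int R) z) \<le> B" if z: "z \<in> ?A" for z :: complex
    proof -
      have gc: "galois_conjugate l z" using irr root z by (auto simp: galois_conjugate_def)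
      consider "z = l" | "z = cnj l" | "z \<in> complex_of_real ` {0<..<1}"
        using assms(1) gc unfolding strong_PV_def by blast
      then show ?thesis
      proof cases
        case 2
        \<comment> \<open>Integer coefficients are fixed by conjugation, so the values at
          \<open>l\<close> and \<open>cnj l\<close> have equal modulus.\<close>
        have "map_poly cnj (map_poly of_int P) = (map_poly of_int P :: complex poly)"
          by (intro poly_eqI) (simp add: coeff_map_poly)
        then have "poly (map_poly of_int P) (cnj l) = cnj (poly (map_poly of_int P) l)"
          by (metis poly_cnj)
        then show ?thesis using P PR[OF z] 2 by (metis complex_mod_cnj)
      next
        case 3
        then obtain t where "z = complex_of_real t" "t \<in> {0..1}" by auto
        then show ?thesis using P(3) PR[OF z] by metis
      qed (use P PR[OF z] in simp)
    qed
    moreover have "degree (map_poly of_int R :: complex poly) < card ?A"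
      using R card by (simp add: degree_map_poly)
    ultimately have "\<forall>i. norm (coeff (map_poly of_int R :: complex poly) i) \<le> C" using C by blast
    then have "\<forall>i. \<bar>coeff R i\<bar> \<le> \<lfloor>C\<rfloor>" by (simp add: coeff_map_poly le_floor_iff)
    then show "x \<in> (\<lambda>R. poly (map_poly of_int R) l) `
        {R. degree R < degree g \<and> (\<forall>i. \<bar>coeff R i\<bar> \<le> \<lfloor>C\<rfloor>)}"
      using R P PR root by auto
  qed
  then show ?thesis using finite_bounded_int_polys finite_surj by blast
qed

text \<open>Otherwise every conjugate has modulus at most 1, and the conjugate \<open>b\<close> in
  (0,1) pushes their product strictly below 1. Up to sign this product is an integer, so it is 0.
  Then 0 is a root of the irreducible \<open>p\<close>, which must divide X, contradicting
  \<open>b > 0\<close>.\<close>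

lemma nontrivial_strong_PV_norm_gt_1:
  assumes "nontrivial_strong_PV l"
  shows "norm l > 1"
proof (rule ccontr)
  assume "\<not> norm l > 1"
  obtain b where b: "galois_conjugate l b" "b \<in> complex_of_real ` {0<..<1}" and "strong_PV l"
    using assms by (auto simp: nontrivial_strong_PV_def)
  then obtain p where p: "irreducible p" "poly (map_poly of_rat p) l = 0" "poly (map_poly of_rat p) b = 0"
    by (auto simp: galois_conjugate_def)
  let ?A = "{z::complex. poly (map_poly of_rat p) z = 0}"
  obtain g c where g: "lead_coeff g = 1" "c \<noteq> 0" "map_poly of_int g = smult c p"
    using monic_integral_multiple[OF p(1,2)] \<open>strong_PV l\<close> by (auto simp: strong_PV_def)
  have fin: "finite ?A" using separable_decomposition[OF p(1)] by simp
  have lc: "c * lead_coeff p = 1"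
    using arg_cong[OF g(3), of lead_coeff] g(1,2) by (simp add: degree_map_poly coeff_map_poly)
  have "map_poly of_int g = smult (of_rat c) (map_poly of_rat p :: complex poly)"
    using arg_cong[OF g(3), of "map_poly (of_rat :: rat \<Rightarrow> complex)"]
    by (simp add: map_poly_of_rat_of_int map_poly_of_rat_smult)
  also have "\<dots> = (\<Prod>z\<in>?A. [:-z, 1:])"
    by (subst separable_decomposition(2)[OF p(1)]) (simp add: lc flip: of_rat_mult)
  \<comment> \<open>Evaluation at 0 turns the factorization into the norm of \<open>l\<close>, up to
    sign.\<close>
  finally have "poly (map_poly of_int g) 0 = (\<Prod>z\<in>?A. - z)" by (simp add: poly_prod)
  then have "norm (of_int (coeff g 0) :: complex) = (\<Prod>z\<in>?A. norm z)"
    by (simp add: poly_0_coeff_0 coeff_map_poly norm_minus_cancel flip: prod_norm)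
  also have "\<dots> < 1"
  proof -
    have le: "norm z \<le> 1" if "z \<in> ?A" for z
    proof -
      have "galois_conjugate l z" using p that by (auto simp: galois_conjugate_def)
      then consider "z = l" | "z = cnj l" | "z \<in> complex_of_real ` {0<..<1}"
        using \<open>strong_PV l\<close> unfolding strong_PV_def by blast
      then show ?thesis using \<open>\<not> norm l > 1\<close> by cases auto
    qed
    have "(\<Prod>z\<in>?A. norm z) = norm b * (\<Prod>z\<in>?A - {b}. norm z)"
      using fin p by (intro prod.remove) auto
    also have "\<dots> \<le> norm b * 1"
      using le by (intro mult_left_mono prod_le_1) auto
    also have "\<dots> < 1" using b by auto
    finally show ?thesis .
  qed
  finally have "coeff g 0 = 0" by simp
  then have "p dvd [:0, 1:]"
  proof -
    have "c * coeff p 0 = 0"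
      using arg_cong[OF g(3), of "\<lambda>q. coeff q 0"] \<open>coeff g 0 = 0\<close> by (simp add: coeff_map_poly)
    then have "poly (map_poly of_rat p) (0::complex) = 0"
      using g(2) by (simp add: poly_0_coeff_0 coeff_map_poly)
    then show ?thesis
      using irreducible_dvd_of_root[OF p(1), of 0 "[:0, 1:]"] by (simp add: map_poly_pCons)
  qed
  then obtain q where "[:0, 1:] = p * q" by blast
  then have "poly (map_poly of_rat [:0, 1:]) b = 0"
    by (simp only: map_poly_of_rat_mult poly_mult p)  simp
  with b show False by (auto simp: map_poly_pCons)
qed

text \<open>A difference of two differences is the value at \<open>l\<close> of
  \<open>(P1 - P2) - (P3 - P4)\<close>, where each of the four polynomials maps [0,1] into itself.
  The combination is therefore bounded by 2 there, and the finiteness result with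
  \<open>B = 2\<close> covers all short differences.\<close>

lemma Q_set_differences_discrete:
  assumes "strong_PV l" "irreducible p" "poly (map_poly of_rat p) l = 0"
  shows "uniform_discrete {x - y | x y. x \<in> Q_set l \<and> y \<in> Q_set l}"
proof -
  let ?T = "{poly (map_poly of_int P) l | P. norm (poly (map_poly of_int P) l) \<le> 2 \<and>
    (\<forall>t\<in>{0..1}. norm (poly (map_poly of_int P) (complex_of_real t)) \<le> 2)}"
  obtain d where d: "d > 0" "\<forall>x\<in>?T. x \<noteq> 0 \<longrightarrow> d \<le> dist 0 x"
    using finite_set_avoid[OF strong_PV_finite[OF assms, of 2], of 0] by blast
  show ?thesis
  proof (rule uniformI1[of "min d 2"])
    fix x y assume "x \<in> {x - y | x y. x \<in> Q_set l \<and> y \<in> Q_set l}"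
      "y \<in> {x - y | x y. x \<in> Q_set l \<and> y \<in> Q_set l}" and xy: "dist x y < min d 2"
    then obtain x1 x2 y1 y2 where Q: "x1 \<in> Q_set l" "x2 \<in> Q_set l" "y1 \<in> Q_set l" "y2 \<in> Q_set l"
      and x: "x = x1 - x2" and y: "y = y1 - y2" by blast
    let ?good = "\<lambda>P. \<forall>t\<in>{0..1}. \<exists>r\<in>{0..1}. poly (map_poly of_int P) (of_real t) = (of_real r :: complex)"
    obtain P1 where P1: "x1 = poly (map_poly of_int P1) l" "?good P1" using Q_set_int_poly[OF Q(1)] by blast
    obtain P2 where P2: "x2 = poly (map_poly of_int P2) l" "?good P2" using Q_set_int_poly[OF Q(2)] by blast
    obtain P3 where P3: "y1 = poly (map_poly of_int P3) l" "?good P3" using Q_set_int_poly[OF Q(3)] by blast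
    obtain P4 where P4: "y2 = poly (map_poly of_int P4) l" "?good P4" using Q_set_int_poly[OF Q(4)] by blast
    let ?P = "(P1 - P2) - (P3 - P4)"
    have ev: "x - y = poly (map_poly of_int ?P) l"
      by (simp add: x y P1 P2 P3 P4 map_poly_of_int_diff)
    moreover have "norm (poly (map_poly of_int ?P) (complex_of_real t)) \<le> 2" if t: "t \<in> {0..1}" for t
    proof -
      obtain r1 where r1: "r1 \<in> {0..1}" "poly (map_poly of_int P1) (of_real t) = (of_real r1 :: complex)"
        using bspec[OF P1(2) t] by blast
      obtain r2 where r2: "r2 \<in> {0..1}" "poly (map_poly of_int P2) (of_real t) = (of_real r2 :: complex)"
        using bspec[OF P2(2) t] by blast
      obtain r3 where r3: "r3 \<in> {0..1}" "poly (map_poly of_int P3) (of_real t) = (of_real r3 :: complex)"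
        using bspec[OF P3(2) t] by blast
      obtain r4 where r4: "r4 \<in> {0..1}" "poly (map_poly of_int P4) (of_real t) = (of_real r4 :: complex)"
        using bspec[OF P4(2) t] by blast
      have "poly (map_poly of_int ?P) (complex_of_real t) = of_real ((r1 - r2) - (r3 - r4))"
        by (simp add: map_poly_of_int_diff r1 r2 r3 r4)
      moreover have "\<bar>(r1 - r2) - (r3 - r4)\<bar> \<le> 2" using r1(1) r2(1) r3(1) r4(1) by auto
      ultimately show ?thesis by (simp only: norm_of_real)
    qed
    moreover have "norm (x - y) \<le> 2" using xy by (simp add: dist_norm)
    ultimately have "x - y \<in> ?T" by (intro CollectI exI[of _ ?P]) simp
    with d xy show "x = y" by (force simp: dist_norm)
  qed (use d in simp)
qed

section \<open>The Meyer property on the line and in the plane\<close>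

theorem corollary15p29:
  fixes l :: complex
  assumes "nontrivial_strong_PV l"
    and "\<exists>u\<in>Q_set l. is_unit_of (int_adjoin l) u \<and> u \<noteq> 1"
  shows "(l \<in> \<real> \<longrightarrow> meyer_set (real_Q_set l)) \<and> (l \<notin> \<real> \<longrightarrow> meyer_set (Q_set l))"
proof -
  obtain p where "strong_PV l" and p: "irreducible p" "poly (map_poly of_rat p) l = 0"
    using assms(1) by (auto simp: nontrivial_strong_PV_def galois_conjugate_def)
  then have disc: "uniform_discrete {x - y | x y. x \<in> Q_set l \<and> y \<in> Q_set l}"
    by (rule Q_set_differences_discrete)
  obtain R where "R > 0"
    and R: "\<And>z. z \<in> (if l \<in> \<real> then \<real> else UNIV) \<Longrightarrow> \<exists>q\<in>Q_set l. norm (z - q) \<le> R"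
    using Q_set_dense[OF refl nontrivial_strong_PV_norm_gt_1[OF assms(1)]] by blast
  show ?thesis
  proof (intro conjI impI)
    assume l: "l \<in> \<real>"
    \<comment> \<open>The radius exceeds \<open>R\<close> because balls are open while the density
      estimate is not strict.\<close>
    have "(\<Union>x\<in>real_Q_set l. ball x (R + 1)) = UNIV"
    proof (intro equalityI subset_UNIV subsetI)
      fix z :: real
      obtain q where q: "q \<in> Q_set l" "norm (of_real z - q) \<le> R" using R[of "of_real z"] l by auto
      with of_real_image_real_Q_set[OF l] obtain x where x: "x \<in> real_Q_set l" "q = of_real x" by blast
      have "norm (complex_of_real (z - x)) \<le> R" using q x by simp
      then have "\<bar>z - x\<bar> \<le> R" by (simp only: norm_of_real)
      then show "z \<in> (\<Union>x\<in>real_Q_set l. ball x (R + 1))"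
        using x by (auto simp: dist_real_def intro!: bexI[of _ x])
    qed
    then have "relatively_dense (real_Q_set l)"
      using \<open>R > 0\<close> unfolding relatively_dense_def by (intro exI[of _ "R + 1"]) simp
    moreover have "uniform_discrete {x - y | x y. x \<in> real_Q_set l \<and> y \<in> real_Q_set l}"
    proof -
      obtain e where e: "e > 0" "\<And>x y. x \<in> {x - y | x y. x \<in> Q_set l \<and> y \<in> Q_set l} \<Longrightarrow>
          y \<in> {x - y | x y. x \<in> Q_set l \<and> y \<in> Q_set l} \<Longrightarrow> dist x y < e \<Longrightarrow> x = y"
        using disc unfolding uniform_discrete_def by blast
      show ?thesis
      proof (rule uniformI1[OF e(1)])
        fix x y
        assume x: "x \<in> {x - y | x y. x \<in> real_Q_set l \<and> y \<in> real_Q_set l}"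
          and y: "y \<in> {x - y | x y. x \<in> real_Q_set l \<and> y \<in> real_Q_set l}" and "dist x y < e"
        \<comment> \<open>The embedding of the line in the plane is isometric, so the same
          separation constant \<open>e\<close> serves for the real set.\<close>
        have "complex_of_real x \<in> {x - y | x y. x \<in> Q_set l \<and> y \<in> Q_set l}"
          "complex_of_real y \<in> {x - y | x y. x \<in> Q_set l \<and> y \<in> Q_set l}"
          using x y by (force simp: real_Q_set_def)+
        moreover have "dist (complex_of_real x) (complex_of_real y) < e"
          using \<open>dist x y < e\<close> by (simp add: dist_of_real)
        ultimately show "x = y" using e(2) of_real_eq_iff by blast
      qed
    qed
    ultimately show "meyer_set (real_Q_set l)" by (simp add: meyer_set_def)
  next
    assume l: "l \<notin> \<real>"
    have "(\<Union>x\<in>Q_set l. ball x (R + 1)) = UNIV"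
    proof (intro equalityI subset_UNIV subsetI)
      fix z
      obtain q where "q \<in> Q_set l" "norm (z - q) \<le> R" using R[of z] l by auto
      then show "z \<in> (\<Union>x\<in>Q_set l. ball x (R + 1))"
        by (auto simp: dist_norm norm_minus_commute intro!: bexI[of _ q])
    qed
    then have "relatively_dense (Q_set l)"
      using \<open>R > 0\<close> unfolding relatively_dense_def by (intro exI[of _ "R + 1"]) simp
    with disc show "meyer_set (Q_set l)" by (simp add: meyer_set_def)
  qed
qed

end
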